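(* Let $(\sigma,\tau)$ be any one of the three pairs $(1234,1243)$, $(1324,1342)$, $(1423,1432)$. Then for all $n\ge 1$ and $1\le i\le n$, $$|\mathcal{S}_{n,i}(\sigma,\tau)|=S_{n,i}.$$
   Context: A permutation $\pi=\pi_1\cdots\pi_n$ of $[n]=\{1,\dots,n\}$ contains the pattern $\tau=\tau_1\cdots\tau_k\in\mathcal{S}_k$ if there are indices $i_1<\cdots<i_k$ such that $\pi_{i_1}\cdots\pi_{i_k}$ is order isomorphic to $\tau$; otherwise $\pi$ avoids $\tau$. $\mathcal{S}_{n,i}(\sigma,\tau)$ denotes the set of permutations $\pi_1\cdots\pi_n$ of $[n]$ avoiding both $\sigma$ and $\tau$ with $\pi_1=i$. The array $S_{n,k}$ ($1\le k\le n$) is defined by $S_{1,1}=S_{2,1}=S_{2,2}=1$ and, for $n\ge 3$, $$S_{n,k}=S_{n,k-1}+2S_{n-1,k}-S_{n-1,k-1},\qquad 1\le k\le n-2,$$ together with $S_{n,n}=S_{n,n-1}=S_{n,n-2}$, where $S_{m,0}=0$ for all $m$. *)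

theory Defs
  imports Main "HOL-Combinatorics.Multiset_Permutations"
begin

text \<open>A permutation of \<open>[n]\<close> is written in one-line notation, as an element of
  \<^term>\<open>permutations_of_set {1..n}\<close>; list positions are counted from 0, values from 1.\<close>

definition contains_pattern :: "nat list \<Rightarrow> nat list \<Rightarrow> bool" where
  "contains_pattern \<pi> \<tau> \<longleftrightarrow>
     (\<exists>f :: nat \<Rightarrow> nat. strict_mono_on {..<length \<tau>} f \<and> f ` {..<length \<tau>} \<subseteq> {..<length \<pi>} \<and>
        (\<forall>a<length \<tau>. \<forall>b<length \<tau>. \<pi> ! f a < \<pi> ! f b \<longleftrightarrow> \<tau> ! a < \<tau> ! b))"

definition avoids_pattern :: "nat list \<Rightarrow> nat list \<Rightarrow> bool" where
  "avoids_pattern \<pi> \<tau> \<longleftrightarrow> \<not> contains_pattern \<pi> \<tau>"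

definition avoiders_from :: "nat \<Rightarrow> nat \<Rightarrow> nat list \<Rightarrow> nat list \<Rightarrow> nat list set" where
  "avoiders_from n i \<sigma> \<tau> =
     {\<pi> \<in> permutations_of_set {1..n}. avoids_pattern \<pi> \<sigma> \<and> avoids_pattern \<pi> \<tau> \<and> hd \<pi> = i}"

text \<open>The array is integer-valued so that the subtraction is not truncated.  Outside
  \<open>1 \<le> k \<le> n\<close> the value is 0; the recurrence only relies on this for \<open>k = 0\<close>.\<close>

fun S_array :: "nat \<Rightarrow> nat \<Rightarrow> int" where
  "S_array n k =
     (if k = 0 \<or> n < k then 0
      else if n \<le> 2 then 1
      else if k \<le> n - 2 then S_array n (k - 1) + 2 * S_array (n - 1) k - S_array (n - 1) (k - 1)
      else S_array n (n - 2))"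

declare S_array.simps [simp del]

lemma S_array_zero: "S_array m 0 = 0"
  by (simp add: S_array.simps)

lemma S_array_init: "S_array 1 1 = 1" "S_array 2 1 = 1" "S_array 2 2 = 1"
  by (simp_all add: S_array.simps)

lemma S_array_rec:
  assumes "n \<ge> 3" "1 \<le> k" "k \<le> n - 2"
  shows "S_array n k = S_array n (k - 1) + 2 * S_array (n - 1) k - S_array (n - 1) (k - 1)"
  using assms by (subst S_array.simps) auto

lemma S_array_last:
  assumes "n \<ge> 3"
  shows "S_array n n = S_array n (n - 1)" "S_array n (n - 1) = S_array n (n - 2)"
proof -
  have "S_array n n = S_array n (n - 2)"
    using assms by (subst S_array.simps) auto
  moreover have *: "S_array n (n - 1) = S_array n (n - 2)"
    using assms by (subst S_array.simps) auto
  ultimately show "S_array n n = S_array n (n - 1)" by simp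
  show "S_array n (n - 1) = S_array n (n - 2)" by (fact *)
qed

end

theory Submission
  imports Defs "HOL-Library.Sublist"
begin

text \<open>In each of the three pairs both patterns begin with their minimum \<open>1\<close>, share the
  second letter, and differ only by exchanging the last two.  Containing one of the two patterns
  therefore means: there are entries \<open>x\<close>, \<open>y\<close> in this order and two later entries \<open>u\<close>, \<open>v\<close>, in
  either order, with \<open>x\<close> smallest and \<open>u\<close>, \<open>v\<close> placed relative to \<open>y\<close> as the pair prescribes: both
  above \<open>y\<close>, one on each side of \<open>y\<close>, or both below \<open>y\<close>.  The role of \<open>x\<close> may always be given to
  the smallest entry that precedes \<open>y\<close>.

  Read an avoiding permutation from left to right, and let \<open>m\<close> be the running minimum.  If the next
  entry is below \<open>m\<close>, it imposes no condition and becomes the new minimum.  If the next entry \<open>y\<close> is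
  above \<open>m\<close>, then among the unread entries above \<open>m\<close> it must be one of the top two, one of the two
  extremes, or one of the bottom two, according to the pair.  In every case \<open>min 2 a\<close> entries are
  allowed if \<open>a\<close> unread entries exceed \<open>m\<close>, so the three counts agree.

  Consequently the number \<open>T n k\<close> of avoiders of length \<open>n\<close> that start with \<open>k\<close> satisfies
  \<open>T (n + 1) (k + 1) = min 2 (n - k) * T n (k + 1) + (\<Sum>j<k. T n (j + 1))\<close>; this is the induction in
  \<open>card_unforked\<close>.  Subtracting consecutive instances of this equation in \<open>k\<close> gives the defining
  recurrence of the array, and \<open>S_array_step\<close> reverses that subtraction.\<close>

section \<open>Patterns as subsequences\<close>

lemma contains_pattern_iff_subseq:
  "contains_pattern \<pi> \<tau> \<longleftrightarrow>
     (\<exists>\<rho>. subseq \<rho> \<pi> \<and> length \<rho> = length \<tau> \<and>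
        (\<forall>a<length \<tau>. \<forall>b<length \<tau>. \<rho> ! a < \<rho> ! b \<longleftrightarrow> \<tau> ! a < \<tau> ! b))"
    (is "_ \<longleftrightarrow> ?R")
proof
  assume "contains_pattern \<pi> \<tau>"
  then obtain f :: "nat \<Rightarrow> nat" where mono: "strict_mono_on {..<length \<tau>} f"
    and ran: "f ` {..<length \<tau>} \<subseteq> {..<length \<pi>}"
    and iso: "\<forall>a<length \<tau>. \<forall>b<length \<tau>. \<pi> ! f a < \<pi> ! f b \<longleftrightarrow> \<tau> ! a < \<tau> ! b"
    unfolding contains_pattern_def by blast
  let ?I = "map f [0..<length \<tau>]"
  \<comment> \<open>Two strictly increasing lists with the same elements are equal, so the list of chosen positions
    arises by filtering the list of all positions and is a subsequence of it.\<close>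
  let ?J = "filter (\<lambda>k. k \<in> set ?I) [0..<length \<pi>]"
  have "sorted_wrt (<) ?I"
    using mono by (auto simp: sorted_wrt_iff_nth_less strict_mono_on_def)
  moreover have "sorted_wrt (<) ?J"
    by (intro sorted_wrt_filter) simp
  moreover have "set ?J = set ?I"
    using ran by (auto simp: lessThan_atLeast0)
  ultimately have "?I = ?J"
    by (metis strict_sorted_equal)
  then have "subseq ?I [0..<length \<pi>]"
    by (metis subseq_filter_left)
  then have "subseq (map ((!) \<pi>) ?I) (map ((!) \<pi>) [0..<length \<pi>])"
    by (rule subseq_map)
  then have "subseq (map ((!) \<pi>) ?I) \<pi>"
    by (simp only: map_nth)
  then show ?R
    using iso by (intro exI[of _ "map ((!) \<pi>) ?I"]) simp
next
  assume ?R
  then obtain \<rho> where sub: "subseq \<rho> \<pi>" and len: "length \<rho> = length \<tau>"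
    and iso: "\<forall>a<length \<tau>. \<forall>b<length \<tau>. \<rho> ! a < \<rho> ! b \<longleftrightarrow> \<tau> ! a < \<tau> ! b"
    by blast
  from sub have "\<exists>f. strict_mono_on {..<length \<rho>} f \<and>
      (\<forall>a<length \<rho>. f a < length \<pi> \<and> \<pi> ! f a = \<rho> ! a)"
  proof induction
    case (list_emb_Nil ys)
    show ?case by (auto simp: strict_mono_on_def)
  next
    case (list_emb_Cons xs ys y)
    then obtain f where "strict_mono_on {..<length xs} f"
      "\<forall>a<length xs. f a < length ys \<and> ys ! f a = xs ! a"
      by blast
    then show ?case
      by (intro exI[of _ "\<lambda>a. Suc (f a)"]) (auto simp: strict_mono_on_def)
  next
    case (list_emb_Cons2 x y xs ys)
    then obtain f where f: "strict_mono_on {..<length xs} f"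
      "\<forall>a<length xs. f a < length ys \<and> ys ! f a = xs ! a"
      by blast
    with \<open>x = y\<close> show ?case
      by (intro exI[of _ "case_nat 0 (\<lambda>a. Suc (f a))"])
         (auto simp: strict_mono_on_def less_Suc_eq_0_disj split: nat.split)
  qed
  then show "contains_pattern \<pi> \<tau>"
    unfolding contains_pattern_def using len iso by (auto simp: image_subset_iff)
qed

lemma contains_pattern_4:
  "contains_pattern \<pi> [a, b, c, d] \<longleftrightarrow>
     (\<exists>x y u v. subseq [x, y, u, v] \<pi> \<and>
        (\<forall>i<4. \<forall>j<4. [x, y, u, v] ! i < [x, y, u, v] ! j \<longleftrightarrow> [a, b, c, d] ! i < [a, b, c, d] ! j))"
  unfolding contains_pattern_iff_subseq
  by (auto simp: length_Suc_conv numeral_eq_Suc)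

lemma subseq_Cons_Cons_iff:
  "subseq (a # as) (b # bs) \<longleftrightarrow> a = b \<and> subseq as bs \<or> subseq (a # as) bs"
  by (auto dest: subseq_Cons')

lemma subseq_pair_iff:
  assumes "u \<noteq> v"
  shows "subseq [u, v] xs \<or> subseq [v, u] xs \<longleftrightarrow> u \<in> set xs \<and> v \<in> set xs"
proof (induction xs)
  case (Cons x xs)
  then show ?case
    using assms by (auto simp: subseq_Cons_Cons_iff subseq_singleton_left)
qed simp

section \<open>Elements of restricted rank in a finite linear order\<close>

text \<open>Strict monotonicity of the rank makes it injective; its values are below \<open>card B\<close>, and a
  cardinality count does the rest.\<close>

lemma (in linorder) rank_bij_betw:
  assumes "finite B"
  shows "bij_betw (\<lambda>y. card {z \<in> B. z < y}) B {..<card B}"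
proof -
  have less: "card {z \<in> B. z < x} < card {z \<in> B. z < y}" if "x \<in> B" "x < y" for x y
    using assms that by (intro psubset_card_mono) auto
  have inj: "inj_on (\<lambda>y. card {z \<in> B. z < y}) B"
  proof (rule inj_onI)
    fix x y assume "x \<in> B" "y \<in> B" "card {z \<in> B. z < x} = card {z \<in> B. z < y}"
    with less[of x y] less[of y x] show "x = y"
      by (cases x y rule: linorder_cases) simp_all
  qed
  have "card {z \<in> B. z < y} < card B" if "y \<in> B" for y
    using assms that by (intro psubset_card_mono) auto
  then have "(\<lambda>y. card {z \<in> B. z < y}) ` B \<subseteq> {..<card B}"
    by blast
  then have "(\<lambda>y. card {z \<in> B. z < y}) ` B = {..<card B}"
    using inj by (intro card_subset_eq) (simp_all add: card_image)
  with inj show ?thesis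
    by (simp add: bij_betw_def)
qed

text \<open>The condition says that the rank of \<open>y\<close>, counted from \<open>0\<close>, is less than \<open>2\<close>.  Stated for an
  arbitrary linear order so that the reversed order gives the count for the top two elements.\<close>

lemma (in linorder) card_at_most_one_below:
  assumes "finite B"
  shows "card {y \<in> B. \<not> (\<exists>u\<in>B. \<exists>v\<in>B. u \<noteq> v \<and> u < y \<and> v < y)} = min 2 (card B)"
proof -
  let ?r = "\<lambda>y. card {z \<in> B. z < y}"
  have "\<not> (\<exists>u\<in>B. \<exists>v\<in>B. u \<noteq> v \<and> u < y \<and> v < y) \<longleftrightarrow> ?r y < 2" for y
    using card_le_Suc0_iff_eq[of "{z \<in> B. z < y}"] assms by (auto simp: less_Suc_eq_le numeral_2_eq_2)
  then have "{y \<in> B. \<not> (\<exists>u\<in>B. \<exists>v\<in>B. u \<noteq> v \<and> u < y \<and> v < y)} = {y \<in> B. ?r y < 2}"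
    by blast
  moreover have "card {y \<in> B. ?r y < 2} = min 2 (card B)"
  proof -
    have inj: "inj_on ?r B" and img: "?r ` B = {..<card B}"
      using rank_bij_betw[OF assms] by (auto simp: bij_betw_def)
    have "?r ` {y \<in> B. ?r y < 2} = ?r ` B \<inter> {..<2}"
      by blast
    also have "\<dots> = {..<min 2 (card B)}"
      unfolding img by auto
    finally have "card (?r ` {y \<in> B. ?r y < 2}) = min 2 (card B)"
      by simp
    moreover have "inj_on ?r {y \<in> B. ?r y < 2}"
      using inj by (rule inj_on_subset) blast
    ultimately show ?thesis
      by (simp add: card_image)
  qed
  ultimately show ?thesis
    by simp
qed

text \<open>Only the minimum and the maximum have nothing on one of their two sides; they coincide exactly
  if \<open>B\<close> is a singleton.\<close>

lemma (in linorder) card_extremal: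
  assumes "finite B"
  shows "card {y \<in> B. \<not> (\<exists>u\<in>B. \<exists>v\<in>B. u < y \<and> y < v)} = min 2 (card B)"
proof (cases "B = {}")
  case False
  have ends: "Min B \<in> B" "Max B \<in> B"
    using assms False by simp_all
  have bounds: "Min B \<le> y" "y \<le> Max B" if "y \<in> B" for y
    using assms that by simp_all
  have inner: "(\<exists>u\<in>B. \<exists>v\<in>B. u < y \<and> y < v) \<longleftrightarrow> y \<noteq> Min B \<and> y \<noteq> Max B" if "y \<in> B" for y
  proof
    assume "\<exists>u\<in>B. \<exists>v\<in>B. u < y \<and> y < v"
    then obtain u v where "u \<in> B" "v \<in> B" "u < y" "y < v"
      by blast
    then have "Min B < y" "y < Max B"
      using le_less_trans[OF bounds(1)] less_le_trans[OF _ bounds(2)] by blast+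
    then show "y \<noteq> Min B \<and> y \<noteq> Max B"
      by (metis less_irrefl)
  next
    assume "y \<noteq> Min B \<and> y \<noteq> Max B"
    then have "Min B < y" "y < Max B"
      using le_neq_trans[OF bounds(1)[OF that]] le_neq_trans[OF bounds(2)[OF that]] by metis+
    then show "\<exists>u\<in>B. \<exists>v\<in>B. u < y \<and> y < v"
      using ends by blast
  qed
  have "{y \<in> B. \<not> (\<exists>u\<in>B. \<exists>v\<in>B. u < y \<and> y < v)} = {y \<in> B. y = Min B \<or> y = Max B}"
    using inner by (intro Collect_cong) auto
  also have "\<dots> = {Min B, Max B}"
    using ends by blast
  finally have "{y \<in> B. \<not> (\<exists>u\<in>B. \<exists>v\<in>B. u < y \<and> y < v)} = {Min B, Max B}" .
  moreover have "card {Min B, Max B} = min 2 (card B)"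
  proof (cases "Min B = Max B")
    case True
    have "y = Min B" if "y \<in> B" for y
      using bounds[OF that] True by (simp add: order.antisym)
    then have "B = {Min B}"
      using False by blast
    then have "card B = card {Min B}"
      by (rule arg_cong)
    then show ?thesis
      using True by simp
  next
    case neq: False
    then have "card {Min B, Max B} = 2"
      by simp
    moreover have "card {Min B, Max B} \<le> card B"
      using assms ends by (intro card_mono) auto
    ultimately show ?thesis
      by simp
  qed
  ultimately show ?thesis
    by simp
qed simp

section \<open>Forks: two later entries in either order\<close>

text \<open>The relation \<open>K y u v\<close> prescribes how the last two entries \<open>u\<close>, \<open>v\<close> of an occurrence lie relative
  to its second entry \<open>y\<close>.  Its symmetry expresses that the pair of patterns allows both orders of
  \<open>u\<close> and \<open>v\<close>.  The assumption \<open>card_free\<close> is the one numerical fact that the enumeration needs from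
  the pair: how many elements of \<open>B\<close> may be read first without branching into two others.\<close>

locale fork =
  fixes K :: "nat \<Rightarrow> nat \<Rightarrow> nat \<Rightarrow> bool"
  assumes K_sym: "K y u v \<Longrightarrow> K y v u"
    and K_neq: "K y u v \<Longrightarrow> u \<noteq> y"
    and card_free: "finite B \<Longrightarrow>
      card {y \<in> B. \<not> (\<exists>u\<in>B. \<exists>v\<in>B. u \<noteq> v \<and> K y u v)} = min 2 (card B)"
begin

text \<open>The bound \<open>x\<close> stands for an entry read before \<open>xs\<close> that serves as the minimum of the occurrence.\<close>

definition forks_above :: "nat \<Rightarrow> nat list \<Rightarrow> bool" where
  "forks_above x xs \<longleftrightarrow>
     (\<exists>y u v. subseq [y, u, v] xs \<and> x < y \<and> x < u \<and> x < v \<and> u \<noteq> v \<and> K y u v)"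

definition forked :: "nat list \<Rightarrow> bool" where
  "forked xs \<longleftrightarrow>
     (\<exists>x y u v. subseq [x, y, u, v] xs \<and> x < y \<and> x < u \<and> x < v \<and> u \<noteq> v \<and> K y u v)"

lemma forked_Nil: "\<not> forked []"
  by (simp add: forked_def)

lemma forks_above_Nil: "\<not> forks_above m []"
  by (simp add: forks_above_def)

lemma forked_Cons: "forked (x # xs) \<longleftrightarrow> forks_above x xs \<or> forked xs"
  unfolding forked_def forks_above_def subseq_Cons_Cons_iff by blast

text \<open>By symmetry of \<open>K\<close> the existence of a fork with branch point \<open>y\<close> depends only on the set of entries
  that follow, not on their order.  This is what lets the enumeration keep track of a set alone.\<close>

lemma forks_above_Cons:
  "forks_above m (y # ys) \<longleftrightarrow>
     m < y \<and> (\<exists>u\<in>set ys. \<exists>v\<in>set ys. m < u \<and> m < v \<and> u \<noteq> v \<and> K y u v) \<or> forks_above m ys"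
proof -
  have "(\<exists>u v. subseq [u, v] ys \<and> m < u \<and> m < v \<and> u \<noteq> v \<and> K y u v) \<longleftrightarrow>
        (\<exists>u\<in>set ys. \<exists>v\<in>set ys. m < u \<and> m < v \<and> u \<noteq> v \<and> K y u v)"
    using K_sym subseq_pair_iff[of _ _ ys] by blast
  then show ?thesis
    unfolding forks_above_def subseq_Cons_Cons_iff by blast
qed

lemma forks_above_mono: "forks_above m xs \<Longrightarrow> m' \<le> m \<Longrightarrow> forks_above m' xs"
  unfolding forks_above_def using le_less_trans by blast

text \<open>Once a smaller entry \<open>y\<close> has been read, it can replace \<open>m\<close> in every occurrence that starts with
  \<open>m\<close>, because \<open>y\<close> itself is too small to be used in such an occurrence.\<close>

lemma forked_new_minimum:
  "y < m \<Longrightarrow> forked (m # y # ys) \<longleftrightarrow> forked (y # ys)"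
  using forks_above_mono[of m ys y] by (auto simp: forked_Cons forks_above_Cons)

text \<open>An entry above the running minimum matters only as a branch point: in any occurrence that starts
  with it, the minimum \<open>m\<close> can take its place.\<close>

lemma forked_above_minimum:
  "m < y \<Longrightarrow> forked (m # y # ys) \<longleftrightarrow>
     (\<exists>u\<in>set ys. \<exists>v\<in>set ys. m < u \<and> m < v \<and> u \<noteq> v \<and> K y u v) \<or> forked (m # ys)"
  using forks_above_mono[of y ys m] by (auto simp: forked_Cons forks_above_Cons)

end

section \<open>The array in summed form\<close>

text \<open>The array is defined by differences along a row; for \<open>k + 2 \<le> n\<close> telescoping the row turns this
  into a sum over the previous row.  For \<open>n \<ge> 2\<close> the last two entries equal their left neighbours, and the
  factor \<open>min 2 (n - k)\<close>, which drops to \<open>1\<close> and \<open>0\<close> there, accounts for this since also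
  \<open>S_array n n = S_array n (n - 1)\<close>.\<close>

lemma S_array_step:
  assumes "n \<ge> 1" "k \<le> n"
  shows "S_array (n + 1) (k + 1) =
           int (min 2 (n - k)) * S_array n (k + 1) + (\<Sum>j<k. S_array n (j + 1))"
proof (cases "n = 1")
  case True
  with \<open>k \<le> n\<close> have "k = 0 \<or> k = 1" by auto
  then show ?thesis
    using True S_array_init by (auto simp: numeral_2_eq_2)
next
  case False
  with assms have n: "n \<ge> 2" by simp
  have small: "S_array (n + 1) (k + 1) = 2 * S_array n (k + 1) + (\<Sum>j<k. S_array n (j + 1))"
    if "k + 2 \<le> n" for k
    using that
  proof (induction k)
    case 0
    then show ?case
      using S_array_rec[of "n + 1" 1] by (simp add: S_array_zero)
  next
    case (Suc k)
    then show ?case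
      using S_array_rec[of "n + 1" "Suc k + 1"] by simp
  qed
  have top: "S_array n n = S_array n (n - 1)"
    using n S_array_last(1)[of n] S_array_init by (cases "n = 2") auto
  obtain l where l: "n = l + 2"
    using n by (metis add.commute le_Suc_ex)
  have last: "S_array (n + 1) (n + 1) = S_array (n + 1) n" "S_array (n + 1) n = S_array (n + 1) (n - 1)"
    using S_array_last[of "n + 1"] n by auto
  have zero: "S_array n (n + 1) = 0"
    by (simp add: S_array.simps)
  consider "k + 2 \<le> n" | "k = l + 1" | "k = l + 2"
    using assms l by linarith
  then show ?thesis
  proof cases
    case 1
    then have "min 2 (n - k) = 2"
      by linarith
    then show ?thesis
      using small[OF 1] by simp
  next
    case 2
    then show ?thesis using small[of l] last top l by simp
  next
    case 3
    then show ?thesis using small[of l] last top zero l by simp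
  qed
qed

section \<open>Enumeration by the first entry\<close>

context fork
begin

text \<open>Removing the first entry \<open>y\<close> of the list gives a smaller instance.  If \<open>y < m\<close> the new minimum
  is \<open>y\<close>, and the number of elements below it is its rank, so these entries contribute each of
  \<open>S_array (card A) (j + 1)\<close> with \<open>j < b\<close> once, where \<open>b\<close> elements of \<open>A\<close> lie below \<open>m\<close>.  If
  \<open>y > m\<close> the minimum stays, and each of the admissible entries counted by \<open>card_free\<close> contributes
  the same term \<open>S_array (card A) (b + 1)\<close>.  Only ranks relative to \<open>A\<close> enter; keeping \<open>A\<close> an arbitrary finite
  set avoids renumbering the entries after each step.\<close>

lemma card_unforked:
  assumes "finite A" "m \<notin> A"
  shows "int (card {ys \<in> permutations_of_set A. \<not> forked (m # ys)}) =
           S_array (card A + 1) (card {z \<in> A. z < m} + 1)"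
  using assms
proof (induction "card A" arbitrary: A m)
  case 0
  then have "A = {}" by simp
  then have "{ys \<in> permutations_of_set A. \<not> forked (m # ys)} = {[]}"
    by (auto simp: forked_Cons forked_Nil forks_above_Nil)
  then show ?case
    using \<open>A = {}\<close> S_array_init by simp
next
  case (Suc n)
  define N where "N = (\<lambda>m A. {ys \<in> permutations_of_set A. \<not> forked (m # ys)})"
  define below above where "below = {z \<in> A. z < m}" and "above = {z \<in> A. m < z}"
  define free where "free = {y \<in> above. \<not> (\<exists>u\<in>above. \<exists>v\<in>above. u \<noteq> v \<and> K y u v)}"
  have finA: "finite A" and neA: "A \<noteq> {}" and cardA: "card A = Suc n"
    using Suc.hyps(2) Suc.prems by auto
  have split: "A = below \<union> above" "below \<inter> above = {}"
    using \<open>m \<notin> A\<close> by (auto simp: below_def above_def) (metis linorder_neqE_nat)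
  have fin: "finite below" "finite above" "free \<subseteq> above"
    using finA by (auto simp: below_def above_def free_def)
  have card_split: "card below + card above = Suc n"
    using cardA split fin by (metis card_Un_disjoint)
  define M where "M = (\<lambda>y. {ys \<in> permutations_of_set (A - {y}). \<not> forked (m # y # ys)})"
  have decomp: "N m A = (\<Union>y\<in>A. (#) y ` M y)"
    using neA by (auto simp: N_def M_def permutations_of_set_nonempty)
  have finM: "finite (M y)" for y
    by (auto simp: M_def)
  have "card (N m A) = (\<Sum>y\<in>A. card ((#) y ` M y))"
    unfolding decomp using finA finM by (intro card_UN_disjoint) auto
  also have "\<dots> = (\<Sum>y\<in>A. card (M y))"
    by (intro sum.cong refl card_image) simp
  also have "\<dots> = (\<Sum>y\<in>below. card (M y)) + (\<Sum>y\<in>above. card (M y))"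
    using fin split by (metis sum.union_disjoint)
  finally have total: "int (card (N m A)) =
      (\<Sum>y\<in>below. int (card (M y))) + (\<Sum>y\<in>above. int (card (M y)))"
    by simp
  have IH: "int (card (N m' (A - {y}))) = S_array (n + 1) (card {z \<in> A - {y}. z < m'} + 1)"
    if "y \<in> A" "m' \<notin> A - {y}" for y m'
    unfolding N_def using Suc.hyps(1)[of "A - {y}" m'] that cardA finA by simp
  \<comment> \<open>New minima: the terms are determined by the rank of \<open>y\<close>, which runs through \<open>{..<card below}\<close>.\<close>
  have "int (card (M y)) = S_array (n + 1) (card {z \<in> below. z < y} + 1)" if "y \<in> below" for y
  proof -
    have "y \<in> A" "y < m" using that by (auto simp: below_def)
    then have "M y = N y (A - {y})" by (simp add: M_def N_def forked_new_minimum)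
    moreover have "{z \<in> A - {y}. z < y} = {z \<in> below. z < y}"
      using \<open>y < m\<close> by (auto simp: below_def)
    ultimately show ?thesis using IH[of y y] \<open>y \<in> A\<close> by simp
  qed
  then have "(\<Sum>y\<in>below. int (card (M y))) =
      (\<Sum>y\<in>below. S_array (n + 1) (card {z \<in> below. z < y} + 1))"
    by simp
  also have "\<dots> = (\<Sum>j<card below. S_array (n + 1) (j + 1))"
    by (rule sum.reindex_bij_betw[OF rank_bij_betw[OF fin(1)]])
  finally have sum_below: "(\<Sum>y\<in>below. int (card (M y))) = \<dots>" .
  \<comment> \<open>Entries above the minimum: whether \<open>y\<close> is admissible does not depend on the rest \<open>ys\<close>, since
    every \<open>ys\<close> has the same set of entries.\<close>
  have "int (card (M y)) = (if y \<in> free then S_array (n + 1) (card below + 1) else 0)"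
    if "y \<in> above" for y
  proof -
    have y: "y \<in> A" "m < y" using that by (auto simp: above_def)
    have "(\<exists>u\<in>set ys. \<exists>v\<in>set ys. m < u \<and> m < v \<and> u \<noteq> v \<and> K y u v) \<longleftrightarrow> y \<notin> free"
      if "ys \<in> permutations_of_set (A - {y})" for ys
    proof -
      have "set ys = A - {y}" using that by (simp add: permutations_of_set_def)
      moreover have "u \<noteq> y \<and> v \<noteq> y" if "K y u v" for u v
        using that K_neq K_sym by blast
      ultimately have "(\<exists>u\<in>set ys. \<exists>v\<in>set ys. m < u \<and> m < v \<and> u \<noteq> v \<and> K y u v) \<longleftrightarrow>
          (\<exists>u\<in>above. \<exists>v\<in>above. u \<noteq> v \<and> K y u v)"
        unfolding above_def by blast
      then show ?thesis
        using \<open>y \<in> above\<close> by (simp add: free_def)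
    qed
    then have "M y = (if y \<in> free then N m (A - {y}) else {})"
      using y by (auto simp: M_def N_def forked_above_minimum)
    moreover have "{z \<in> A - {y}. z < m} = below"
      using y by (auto simp: below_def)
    ultimately show ?thesis using IH[of y m] y \<open>m \<notin> A\<close> by simp
  qed
  then have "(\<Sum>y\<in>above. int (card (M y))) =
      (\<Sum>y\<in>above. if y \<in> free then S_array (n + 1) (card below + 1) else 0)"
    by simp
  also have "\<dots> = int (card free) * S_array (n + 1) (card below + 1)"
    using fin by (simp add: sum.If_cases Int_absorb1 Collect_mem_eq)
  also have "card free = min 2 (n + 1 - card below)"
    using card_free[OF fin(2)] card_split unfolding free_def by simp
  finally have sum_above: "(\<Sum>y\<in>above. int (card (M y))) =
      int (min 2 (n + 1 - card below)) * S_array (n + 1) (card below + 1)" .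
  have "int (card (N m A)) = S_array (n + 1 + 1) (card below + 1)"
    using S_array_step[of "n + 1" "card below"] card_split
    unfolding total sum_below sum_above by simp
  then show ?case
    by (simp add: N_def below_def flip: Suc.hyps(2))
qed

lemma card_avoiders_from:
  assumes pats: "\<And>\<pi>. contains_pattern \<pi> \<sigma> \<or> contains_pattern \<pi> \<tau> \<longleftrightarrow> forked \<pi>"
    and "1 \<le> i" "i \<le> n"
  shows "int (card (avoiders_from n i \<sigma> \<tau>)) = S_array n i"
proof -
  let ?A = "{1..n} - {i}"
  have i: "i \<in> {1..n}" using assms by simp
  have "avoiders_from n i \<sigma> \<tau> = {\<pi> \<in> permutations_of_set {1..n}. \<not> forked \<pi> \<and> hd \<pi> = i}"
    using pats unfolding avoiders_from_def avoids_pattern_def permutations_of_set_def by blast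
  also have "\<dots> = (#) i ` {ys \<in> permutations_of_set ?A. \<not> forked (i # ys)}"
    using i by (auto simp: permutations_of_set_nonempty)
  finally have "card (avoiders_from n i \<sigma> \<tau>) =
      card {ys \<in> permutations_of_set ?A. \<not> forked (i # ys)}"
    by (simp add: card_image)
  moreover have "{z \<in> ?A. z < i} = {1..<i}" using assms by auto
  moreover have "card ?A + 1 = n" using i by (simp add: card_Diff_singleton)
  ultimately show ?thesis
    using card_unforked[of ?A i] assms by simp
qed

end

section \<open>The three pairs of patterns\<close>

text \<open>The names say where the second letter of the patterns lies relative to the last two.\<close>

interpretation low: fork "\<lambda>y u v. y < u \<and> y < v"
proof
  fix B :: "nat set" assume "finite B"
  \<comment> \<open>Having at most one element above \<open>y\<close> is having at most one below it in the reversed order.\<close>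
  interpret dual: linorder "(\<ge>) :: nat \<Rightarrow> nat \<Rightarrow> bool" "(>)" by (rule dual_linorder)
  show "card {y \<in> B. \<not> (\<exists>u\<in>B. \<exists>v\<in>B. u \<noteq> v \<and> y < u \<and> y < v)} = min 2 (card B)"
    using dual.card_at_most_one_below[OF \<open>finite B\<close>] .
qed auto

interpretation mid: fork "\<lambda>y u v. u < y \<and> y < v \<or> v < y \<and> y < u"
proof
  fix B :: "nat set" assume "finite B"
  have "u \<noteq> v \<and> (u < y \<and> y < v \<or> v < y \<and> y < u) \<longleftrightarrow> u < y \<and> y < v \<or> v < y \<and> y < u"
    for u v y :: nat
    by auto
  then have "(\<exists>u\<in>B. \<exists>v\<in>B. u \<noteq> v \<and> (u < y \<and> y < v \<or> v < y \<and> y < u)) \<longleftrightarrow>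
        (\<exists>u\<in>B. \<exists>v\<in>B. u < y \<and> y < v)" for y
    by blast
  then show "card {y \<in> B. \<not> (\<exists>u\<in>B. \<exists>v\<in>B. u \<noteq> v \<and> (u < y \<and> y < v \<or> v < y \<and> y < u))}
      = min 2 (card B)"
    using card_extremal[OF \<open>finite B\<close>] by simp
qed auto

interpretation high: fork "\<lambda>y u v. u < y \<and> v < y"
proof
  fix B :: "nat set" assume "finite B"
  then show "card {y \<in> B. \<not> (\<exists>u\<in>B. \<exists>v\<in>B. u \<noteq> v \<and> u < y \<and> v < y)} = min 2 (card B)"
    by (rule card_at_most_one_below)
qed auto

text \<open>In each of the next three lemmas the two patterns fix the order of \<open>u\<close> and \<open>v\<close> in the two possible
  ways, and their disjunction leaves only \<open>u \<noteq> v\<close> and the position relative to \<open>y\<close>.\<close>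

lemma low_patterns:
  "contains_pattern \<pi> [1,2,3,4] \<or> contains_pattern \<pi> [1,2,4,3] \<longleftrightarrow> low.forked \<pi>"
proof -
  have 1: "contains_pattern \<pi> [1,2,3,4] \<longleftrightarrow>
      (\<exists>x y u v. subseq [x, y, u, v] \<pi> \<and> x < y \<and> y < u \<and> u < v)"
    unfolding contains_pattern_4
    by (intro arg_cong[where f = Ex] ext conj_cong refl) (auto simp: numeral_eq_Suc All_less_Suc2)
  have 2: "contains_pattern \<pi> [1,2,4,3] \<longleftrightarrow>
      (\<exists>x y u v. subseq [x, y, u, v] \<pi> \<and> x < y \<and> y < v \<and> v < u)"
    unfolding contains_pattern_4
    by (intro arg_cong[where f = Ex] ext conj_cong refl) (auto simp: numeral_eq_Suc All_less_Suc2)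
  show ?thesis
    unfolding 1 2 low.forked_def ex_disj_distrib[symmetric] conj_disj_distribL[symmetric]
    by (intro arg_cong[where f = Ex] ext conj_cong refl) auto
qed

lemma mid_patterns:
  "contains_pattern \<pi> [1,3,2,4] \<or> contains_pattern \<pi> [1,3,4,2] \<longleftrightarrow> mid.forked \<pi>"
proof -
  have 1: "contains_pattern \<pi> [1,3,2,4] \<longleftrightarrow>
      (\<exists>x y u v. subseq [x, y, u, v] \<pi> \<and> x < u \<and> u < y \<and> y < v)"
    unfolding contains_pattern_4
    by (intro arg_cong[where f = Ex] ext conj_cong refl) (auto simp: numeral_eq_Suc All_less_Suc2)
  have 2: "contains_pattern \<pi> [1,3,4,2] \<longleftrightarrow>
      (\<exists>x y u v. subseq [x, y, u, v] \<pi> \<and> x < v \<and> v < y \<and> y < u)"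
    unfolding contains_pattern_4
    by (intro arg_cong[where f = Ex] ext conj_cong refl) (auto simp: numeral_eq_Suc All_less_Suc2)
  show ?thesis
    unfolding 1 2 mid.forked_def ex_disj_distrib[symmetric] conj_disj_distribL[symmetric]
    by (intro arg_cong[where f = Ex] ext conj_cong refl) auto
qed

lemma high_patterns:
  "contains_pattern \<pi> [1,4,2,3] \<or> contains_pattern \<pi> [1,4,3,2] \<longleftrightarrow> high.forked \<pi>"
proof -
  have 1: "contains_pattern \<pi> [1,4,2,3] \<longleftrightarrow>
      (\<exists>x y u v. subseq [x, y, u, v] \<pi> \<and> x < u \<and> u < v \<and> v < y)"
    unfolding contains_pattern_4
    by (intro arg_cong[where f = Ex] ext conj_cong refl) (auto simp: numeral_eq_Suc All_less_Suc2)
  have 2: "contains_pattern \<pi> [1,4,3,2] \<longleftrightarrow>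
      (\<exists>x y u v. subseq [x, y, u, v] \<pi> \<and> x < v \<and> v < u \<and> u < y)"
    unfolding contains_pattern_4
    by (intro arg_cong[where f = Ex] ext conj_cong refl) (auto simp: numeral_eq_Suc All_less_Suc2)
  show ?thesis
    unfolding 1 2 high.forked_def ex_disj_distrib[symmetric] conj_disj_distribL[symmetric]
    by (intro arg_cong[where f = Ex] ext conj_cong refl) auto
qed

theorem theorem2:
  fixes \<sigma> \<tau> :: "nat list" and n i :: nat
  assumes "(\<sigma>, \<tau>) \<in> {([1,2,3,4], [1,2,4,3]), ([1,3,2,4], [1,3,4,2]), ([1,4,2,3], [1,4,3,2])}"
    and "n \<ge> 1" and "1 \<le> i" and "i \<le> n"
  shows "int (card (avoiders_from n i \<sigma> \<tau>)) = S_array n i"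
proof -
  consider "\<sigma> = [1,2,3,4]" "\<tau> = [1,2,4,3]" | "\<sigma> = [1,3,2,4]" "\<tau> = [1,3,4,2]"
    | "\<sigma> = [1,4,2,3]" "\<tau> = [1,4,3,2]"
    using assms(1) by blast
  then show ?thesis
  proof cases
    case 1
    with assms low_patterns show ?thesis by (intro low.card_avoiders_from) auto
  next
    case 2
    with assms mid_patterns show ?thesis by (intro mid.card_avoiders_from) auto
  next
    case 3
    with assms high_patterns show ?thesis by (intro high.card_avoiders_from) auto
  qed
qed

end
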